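(* Let $\mathcal{X}\subset\mathbb{R}^n$ be a convex body and let $f:\mathcal{X}\to[-B,B]$ be a continuous convex function. Let $(c_t)_{t\ge 1}$ be the points produced by the center of gravity method: $\mathcal{S}_1=\mathcal{X}$ and, for $t\ge 1$, $$c_t=\frac{1}{\mathrm{vol}(\mathcal{S}_t)}\int_{x\in\mathcal{S}_t}x\,dx,\qquad w_t\in\partial f(c_t),\qquad \mathcal{S}_{t+1}=\mathcal{S}_t\cap\{x\in\mathbb{R}^n:(x-c_t)^\top w_t\le 0\}.$$ For $t\ge 1$ let $x_t\in\mathrm{argmin}_{c\in\{c_1,\dots,c_t\}}f(c)$. Then $$f(x_t)-\min_{x\in\mathcal{X}}f(x)\le 2B\left(1-\frac1e\right)^{t/n}.$$
   Context: A convex body is a compact convex set with non-empty interior. A vector $g\in\mathbb{R}^n$ is a subgradient of $f:\mathcal{X}\to\mathbb{R}$ at $x\in\mathcal{X}$ if $f(x)-f(y)\le g^\top(x-y)$ for all $y\in\mathcal{X}$; $\partial f(x)$ is the set of all subgradients at $x$. $\mathrm{vol}$ is Lebesgue measure. The choice of $w_t$ in $\partial f(c_t)$ is arbitrary (given by a first order oracle). *)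

theory Defs
  imports "HOL-Analysis.Analysis"
begin

definition convex_body :: "'a::euclidean_space set \<Rightarrow> bool" where
  "convex_body X \<longleftrightarrow> compact X \<and> convex X \<and> interior X \<noteq> {}"

text \<open>Subgradients are taken relative to the domain \<open>X\<close> of \<open>f\<close>: only the values of \<open>f\<close> on \<open>X\<close>
  matter, and the notion is meant for base points \<open>x \<in> X\<close>.\<close>

definition subdifferential ::
    "'a::euclidean_space set \<Rightarrow> ('a \<Rightarrow> real) \<Rightarrow> 'a \<Rightarrow> 'a set" where
  "subdifferential X f x = {g. \<forall>y\<in>X. f x - f y \<le> g \<bullet> (x - y)}"

definition center_of_gravity :: "'a::euclidean_space set \<Rightarrow> 'a" where
  "center_of_gravity S = (1 / measure lebesgue S) *\<^sub>R (LINT x:S|lebesgue. x)"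

text \<open>The three sequences form a run of the center of gravity method on \<open>X\<close> and \<open>f\<close>. Indices
  start at 1; the values at index 0 are irrelevant. The oracle answers \<open>w t\<close> are arbitrary
  subgradients, possibly different when the same point is queried twice.\<close>

definition center_of_gravity_method ::
    "'a::euclidean_space set \<Rightarrow> ('a \<Rightarrow> real) \<Rightarrow> (nat \<Rightarrow> 'a set) \<Rightarrow> (nat \<Rightarrow> 'a) \<Rightarrow> (nat \<Rightarrow> 'a) \<Rightarrow> bool"
  where
  "center_of_gravity_method X f S c w \<longleftrightarrow>
     S 1 = X \<and>
     (\<forall>t\<ge>1. c t = center_of_gravity (S t) \<and>
            w t \<in> subdifferential X f (c t) \<and>
            S (t + 1) = S t \<inter> {x. (x - c t) \<bullet> w t \<le> 0})"

end

theory Submission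
  imports Defs
begin

text \<open>
  The function value at the best query point drops geometrically because each query shrinks the
  current set by a constant factor, while the sublevel sets of a convex function cannot be small.

  Let \<open>z\<close> minimise \<open>f\<close> and shrink \<open>X\<close> towards \<open>z\<close> by a factor \<open>\<epsilon>\<close>. The shrunken copy has volume
  \<open>\<epsilon> ^ n * vol X\<close>, and by convexity \<open>f\<close> is at most \<open>f z + 2 * B * \<epsilon>\<close> on it. If \<open>t\<close> cuts leave at most
  \<open>(1 - 1/e) ^ t * vol X\<close>, then as soon as \<open>\<epsilon> ^ n > (1 - 1/e) ^ t\<close> some point of the copy has been cut
  off, say by the query at \<open>c s\<close>; the subgradient inequality makes \<open>f (c s)\<close> smaller than the value of
  \<open>f\<close> at that point. Letting \<open>\<epsilon>\<close> decrease to \<open>(1 - 1/e) powr (t/n)\<close> gives the rate. A zero subgradient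
  does not cut at all, but then the query point is already a minimiser.

  The factor \<open>1 - 1/e\<close> is Gruenbaum's theorem (\<open>grunbaum\<close>): a half-space whose boundary passes through
  the center of gravity of a convex body \<open>K\<close> contains at least \<open>1/e\<close> of its volume. Put
  \<open>V s = vol {x \<in> K. x \<bullet> w \<le> s}\<close> and let \<open>m\<close> be the level of the center of gravity. The function
  \<open>V\<close> is log-concave, so a supporting line of \<open>ln V\<close> at \<open>m\<close> gives \<open>V s \<le> V m * exp (d * (s - m))\<close>. This
  bound reaches \<open>vol K\<close> at \<open>b = m + ln (vol K / V m) / d\<close>. Since \<open>b - y\<close> is the length of \<open>{y..b}\<close>
  for \<open>y \<le> b\<close>, Tonelli turns the integral of \<open>b - x \<bullet> w\<close> over \<open>K\<close>, which is \<open>vol K * (b - m)\<close>, into at most the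
  integral of \<open>V\<close> up to \<open>b\<close>, and so into at most \<open>vol K / d\<close>. Hence \<open>ln (vol K / V m) \<le> 1\<close>.

  Log-concavity of \<open>V\<close> is the multiplicative Brunn-Minkowski inequality (\<open>brunn_minkowski_open\<close>) for caps
  of \<open>K\<close>. It is proved by the method of Hadwiger and Ohmann, which needs no induction on the dimension:
  for two boxes it is the weighted inequality of arithmetic and geometric means in every coordinate;
  finite disjoint unions of boxes are cut by parallel hyperplanes into parts of equal proportion with
  fewer boxes; open sets are exhausted by such unions.
\<close>

section \<open>Half-open boxes\<close>

text \<open>Boxes are half-open so that a hyperplane splits a box exactly into two
  disjoint boxes, and so that every nonempty box has positive volume.\<close>

definition half_open_box :: "'a::euclidean_space \<Rightarrow> 'a \<Rightarrow> 'a set" where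
  "half_open_box a b = {x. \<forall>i\<in>Basis. a \<bullet> i \<le> x \<bullet> i \<and> x \<bullet> i < b \<bullet> i}"

lemma half_open_box_nonempty_iff: "half_open_box a b \<noteq> {} \<longleftrightarrow> (\<forall>i\<in>Basis. a \<bullet> i < b \<bullet> i)"
proof
  assume "\<forall>i\<in>Basis. a \<bullet> i < b \<bullet> i"
  then have "a \<in> half_open_box a b" by (auto simp: half_open_box_def)
  then show "half_open_box a b \<noteq> {}" by blast
qed (force simp: half_open_box_def)

lemma negligible_symdiff_half_open_box:
  "negligible (cbox a b - half_open_box a b \<union> (half_open_box a b - cbox a b))"
  by (rule negligible_subset[OF negligible_frontier_interval[of a b]])
    (force simp: half_open_box_def mem_box)

lemma lmeasurable_half_open_box: "half_open_box a b \<in> lmeasurable"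
  using lmeasurable_negligible_symdiff[OF lmeasurable_cbox negligible_symdiff_half_open_box] .

lemma measure_half_open_box:
  assumes "\<And>i. i \<in> Basis \<Longrightarrow> a \<bullet> i \<le> b \<bullet> i"
  shows "measure lebesgue (half_open_box a b) = (\<Prod>i\<in>Basis. b \<bullet> i - a \<bullet> i)"
  using measure_negligible_symdiff[OF lmeasurable_cbox negligible_symdiff_half_open_box, of a b]
    content_cbox[of a b] assms by (simp add: measure_completion)

lemma half_open_box_measure_pos:
  assumes "half_open_box a b \<noteq> {}"
  shows "measure lebesgue (half_open_box a b) > 0"
  using assms unfolding half_open_box_nonempty_iff
  by (subst measure_half_open_box) (auto intro!: prod_pos less_imp_le)

text \<open>The combination of two boxes contains the box with the combined corners, whose side
  lengths are the weighted arithmetic means of the given ones. They dominate the weighted geometric means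
  by Young's inequality, and volumes are products of side lengths.\<close>

lemma brunn_minkowski_half_open_box:
  fixes u v :: real
  assumes ne: "half_open_box a b \<noteq> {}" "half_open_box a' b' \<noteq> {}"
    and uv: "u \<ge> 0" "v \<ge> 0" "u + v = 1"
    and C: "C \<in> lmeasurable"
    and sub: "\<And>x y. x \<in> half_open_box a b \<Longrightarrow> y \<in> half_open_box a' b' \<Longrightarrow> u *\<^sub>R x + v *\<^sub>R y \<in> C"
  shows "measure lebesgue (half_open_box a b) powr u * measure lebesgue (half_open_box a' b') powr v
    \<le> measure lebesgue C"
proof -
  have ab: "a \<bullet> i < b \<bullet> i" "a' \<bullet> i < b' \<bullet> i" if "i \<in> Basis" for i
    using ne that unfolding half_open_box_nonempty_iff by auto
  define p where "p = u *\<^sub>R a + v *\<^sub>R a'"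
  define q where "q = u *\<^sub>R b + v *\<^sub>R b'"
  have len: "q \<bullet> i - p \<bullet> i = u * (b \<bullet> i - a \<bullet> i) + v * (b' \<bullet> i - a' \<bullet> i)" for i
    by (simp add: p_def q_def algebra_simps)
  have young: "(b \<bullet> i - a \<bullet> i) powr u * (b' \<bullet> i - a' \<bullet> i) powr v \<le> q \<bullet> i - p \<bullet> i"
    if "i \<in> Basis" for i
    unfolding len using Youngs_inequality_0[OF uv, of "b \<bullet> i - a \<bullet> i" "b' \<bullet> i - a' \<bullet> i"] ab[OF that]
    by simp
  have pq: "p \<bullet> i < q \<bullet> i" if "i \<in> Basis" for i
  proof -
    have "(b \<bullet> i - a \<bullet> i) powr u * (b' \<bullet> i - a' \<bullet> i) powr v > 0" using ab[OF that] by simp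
    then show ?thesis using young[OF that] by linarith
  qed
  have "half_open_box p q \<subseteq> C"
  proof
    fix z assume z: "z \<in> half_open_box p q"
    \<comment> \<open>In each coordinate, \<open>z\<close>, \<open>x\<close> and \<open>y\<close> divide their intervals in the same ratio.\<close>
    define r where "r i = (z \<bullet> i - p \<bullet> i) / (q \<bullet> i - p \<bullet> i)" for i
    have r: "0 \<le> r i" "r i < 1" "z \<bullet> i = p \<bullet> i + r i * (q \<bullet> i - p \<bullet> i)" if "i \<in> Basis" for i
      using z pq[OF that] that by (auto simp: r_def half_open_box_def)
    define x where "x = (\<Sum>i\<in>Basis. (a \<bullet> i + r i * (b \<bullet> i - a \<bullet> i)) *\<^sub>R i)"
    define y where "y = (\<Sum>i\<in>Basis. (a' \<bullet> i + r i * (b' \<bullet> i - a' \<bullet> i)) *\<^sub>R i)"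
    have xi: "x \<bullet> i = a \<bullet> i + r i * (b \<bullet> i - a \<bullet> i)" "y \<bullet> i = a' \<bullet> i + r i * (b' \<bullet> i - a' \<bullet> i)"
      if "i \<in> Basis" for i
      using that by (simp_all add: x_def y_def)
    have aux: "l \<le> l + t * (h - l) \<and> l + t * (h - l) < h" if "l < h" "0 \<le> t" "t < 1" for l h t :: real
    proof -
      have "t * (h - l) < h - l" using mult_strict_right_mono[of t 1 "h - l"] that by simp
      moreover have "0 \<le> t * (h - l)" using that by (intro mult_nonneg_nonneg) auto
      ultimately show ?thesis by (intro conjI) linarith+
    qed
    have "x \<in> half_open_box a b" "y \<in> half_open_box a' b'"
      unfolding half_open_box_def using aux[OF ab(1) r(1,2)] aux[OF ab(2) r(1,2)] by (simp_all add: xi)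
    then have "u *\<^sub>R x + v *\<^sub>R y \<in> C" by (rule sub)
    moreover have "z = u *\<^sub>R x + v *\<^sub>R y"
    proof (rule euclidean_eqI)
      fix i :: 'a assume i: "i \<in> Basis"
      show "z \<bullet> i = (u *\<^sub>R x + v *\<^sub>R y) \<bullet> i"
        unfolding r(3)[OF i] len by (simp add: inner_add_left xi[OF i] p_def algebra_simps)
    qed
    ultimately show "z \<in> C" by simp
  qed
  then have "measure lebesgue (half_open_box p q) \<le> measure lebesgue C"
    using C lmeasurable_half_open_box by (intro measure_mono_fmeasurable) auto
  moreover have "measure lebesgue (half_open_box a b) powr u * measure lebesgue (half_open_box a' b') powr v
    = (\<Prod>i\<in>Basis. (b \<bullet> i - a \<bullet> i) powr u * (b' \<bullet> i - a' \<bullet> i) powr v)"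
    using ab by (simp add: measure_half_open_box less_imp_le prod_powr_distrib prod.distrib)
  moreover have "\<dots> \<le> (\<Prod>i\<in>Basis. q \<bullet> i - p \<bullet> i)"
    using young by (intro prod_mono) auto
  moreover have "\<dots> = measure lebesgue (half_open_box p q)"
    using pq by (simp add: measure_half_open_box less_imp_le)
  ultimately show ?thesis by linarith
qed

section \<open>Finite disjoint unions of boxes\<close>

definition box_partition :: "'a::euclidean_space set set \<Rightarrow> bool" where
  "box_partition \<A> \<longleftrightarrow>
     finite \<A> \<and> disjoint \<A> \<and> (\<forall>K\<in>\<A>. K \<noteq> {} \<and> (\<exists>a b. K = half_open_box a b))"

lemma box_partition_lmeasurable: "box_partition \<A> \<Longrightarrow> \<Union>\<A> \<in> lmeasurable"
  unfolding box_partition_def by (metis fmeasurable.finite_Union lmeasurable_half_open_box subsetI)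

lemma half_open_box_bounded: "bounded (half_open_box a b)"
proof (rule bounded_subset[OF bounded_cbox])
  show "half_open_box a b \<subseteq> cbox a b"
    unfolding half_open_box_def subset_iff mem_box mem_Collect_eq by (meson less_imp_le)
qed

lemma box_partition_bounded: "box_partition \<A> \<Longrightarrow> bounded (\<Union>\<A>)"
  unfolding box_partition_def by (metis bounded_Union half_open_box_bounded)

lemma box_partition_member_pos: "box_partition \<A> \<Longrightarrow> K \<in> \<A> \<Longrightarrow> measure lebesgue K > 0"
  unfolding box_partition_def by (metis half_open_box_measure_pos)

text \<open>Boxes that miss \<open>H\<close> are dropped, so that restricting to a half-space which misses
  some box makes the family strictly smaller; the induction for the Brunn-Minkowski inequality is on the
  number of boxes.\<close>

definition restrict_partition :: "'a set set \<Rightarrow> 'a set \<Rightarrow> 'a set set" where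
  "restrict_partition \<A> H = (\<lambda>K. K \<inter> H) ` \<A> - {{}}"

lemma Union_restrict_partition: "\<Union>(restrict_partition \<A> H) = \<Union>\<A> \<inter> H"
  unfolding restrict_partition_def by auto

lemma half_open_box_Int_halfspace_lt:
  assumes "i \<in> Basis"
  shows "\<exists>b'. half_open_box a b \<inter> {x. x \<bullet> i < s} = half_open_box a b'"
  using assms
  by (intro exI[of _ "\<Sum>j\<in>Basis. (if j = i then min (b \<bullet> i) s else b \<bullet> j) *\<^sub>R j"])
     (auto simp: half_open_box_def split: if_splits)

lemma half_open_box_Int_halfspace_ge:
  assumes "i \<in> Basis"
  shows "\<exists>a'. half_open_box a b \<inter> {x. x \<bullet> i \<ge> s} = half_open_box a' b"
  using assms
  by (intro exI[of _ "\<Sum>j\<in>Basis. (if j = i then max (a \<bullet> i) s else a \<bullet> j) *\<^sub>R j"])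
     (auto simp: half_open_box_def split: if_splits)

lemma box_partition_restrict:
  assumes "box_partition \<A>" and "\<And>a b. \<exists>a' b'. half_open_box a b \<inter> H = half_open_box a' b'"
  shows "box_partition (restrict_partition \<A> H)"
proof -
  have "disjoint (restrict_partition \<A> H)"
  proof (rule disjointI)
    fix K L assume "K \<in> restrict_partition \<A> H" "L \<in> restrict_partition \<A> H" "K \<noteq> L"
    then obtain K' L' where "K' \<in> \<A>" "L' \<in> \<A>" "K = K' \<inter> H" "L = L' \<inter> H"
      unfolding restrict_partition_def by blast
    moreover from this have "K' \<inter> L' = {}"
      using assms(1) \<open>K \<noteq> L\<close> unfolding box_partition_def disjoint_def by blast
    ultimately show "K \<inter> L = {}" by blast
  qed
  moreover have "K \<noteq> {} \<and> (\<exists>a b. K = half_open_box a b)" if "K \<in> restrict_partition \<A> H" for K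
  proof -
    from that obtain K' where K': "K' \<in> \<A>" "K = K' \<inter> H" "K \<noteq> {}"
      unfolding restrict_partition_def by blast
    then obtain a b where "K' = half_open_box a b" using assms(1) unfolding box_partition_def by blast
    then show ?thesis using assms(2)[of a b] K' by blast
  qed
  moreover have "finite (restrict_partition \<A> H)"
    using assms(1) unfolding box_partition_def restrict_partition_def by simp
  ultimately show ?thesis unfolding box_partition_def by blast
qed

lemma box_partition_restrict_halfspace:
  assumes "box_partition \<A>" "i \<in> Basis"
  shows "box_partition (restrict_partition \<A> {x. x \<bullet> i < s})"
    and "box_partition (restrict_partition \<A> {x. x \<bullet> i \<ge> s})"
proof -
  show "box_partition (restrict_partition \<A> {x. x \<bullet> i < s})"
    by (rule box_partition_restrict[OF assms(1)]) (rule exI, rule half_open_box_Int_halfspace_lt[OF assms(2)])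
  show "box_partition (restrict_partition \<A> {x. x \<bullet> i \<ge> s})"
  proof (rule box_partition_restrict[OF assms(1)])
    fix a b :: 'a
    obtain a' where "half_open_box a b \<inter> {x. x \<bullet> i \<ge> s} = half_open_box a' b"
      using half_open_box_Int_halfspace_ge[OF assms(2)] by metis
    then show "\<exists>a' b'. half_open_box a b \<inter> {x. x \<bullet> i \<ge> s} = half_open_box a' b'" by metis
  qed
qed

lemma card_restrict_partition_le:
  "finite \<A> \<Longrightarrow> card (restrict_partition \<A> H) \<le> card \<A>"
  unfolding restrict_partition_def
  by (rule le_trans[OF card_Diff1_le card_image_le])

lemma card_restrict_partition_less:
  assumes "finite \<A>" "K \<in> \<A>" "K \<inter> H = {}"
  shows "card (restrict_partition \<A> H) < card \<A>"
proof -
  have "card (restrict_partition \<A> H) \<le> card (restrict_partition (\<A> - {K}) H)"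
    using assms by (intro card_mono) (auto simp: restrict_partition_def)
  also have "\<dots> \<le> card (\<A> - {K})" using assms by (intro card_restrict_partition_le) auto
  also have "\<dots> < card \<A>" using assms by (meson card_Diff1_less)
  finally show ?thesis .
qed

lemma lmeasurable_Int_halfspace:
  fixes S :: "'a::euclidean_space set"
  assumes "S \<in> lmeasurable"
  shows "S \<inter> {x. x \<bullet> w < s} \<in> lmeasurable" "S \<inter> {x. x \<bullet> w \<ge> s} \<in> lmeasurable"
    "S \<inter> {x. x \<bullet> w \<le> s} \<in> lmeasurable"
proof -
  have "open {x. x \<bullet> w < s}" "closed {x. x \<bullet> w \<ge> s}" "closed {x. x \<bullet> w \<le> s}"
    by (intro open_Collect_less closed_Collect_le continuous_intros)+
  then have "{x. x \<bullet> w < s} \<in> sets lebesgue" "{x. x \<bullet> w \<ge> s} \<in> sets lebesgue" "{x. x \<bullet> w \<le> s} \<in> sets lebesgue"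
    by (simp_all add: lborelD borel_open borel_closed)
  then show "S \<inter> {x. x \<bullet> w < s} \<in> lmeasurable" "S \<inter> {x. x \<bullet> w \<ge> s} \<in> lmeasurable"
    "S \<inter> {x. x \<bullet> w \<le> s} \<in> lmeasurable"
    using assms by (blast intro: fmeasurable_Int_fmeasurable)+
qed

lemma measure_split_halfspace:
  fixes S :: "'a::euclidean_space set"
  assumes "S \<in> lmeasurable"
  shows "measure lebesgue S =
    measure lebesgue (S \<inter> {x. x \<bullet> w < s}) + measure lebesgue (S \<inter> {x. x \<bullet> w \<ge> s})"
proof -
  let ?L = "S \<inter> {x. x \<bullet> w < s}" and ?R = "S \<inter> {x. x \<bullet> w \<ge> s}"
  have "measure lebesgue (?L \<union> ?R) = measure lebesgue ?L + measure lebesgue ?R - measure lebesgue (?L \<inter> ?R)"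
    by (intro measure_Un3 lmeasurable_Int_halfspace assms)
  moreover have "(S \<inter> {x. x \<bullet> w < s}) \<union> (S \<inter> {x. x \<bullet> w \<ge> s}) = S"
    "(S \<inter> {x. x \<bullet> w < s}) \<inter> (S \<inter> {x. x \<bullet> w \<ge> s}) = {}" by auto
  ultimately show ?thesis by simp
qed

text \<open>The volume below the hyperplane at height \<open>s\<close> is Lipschitz in \<open>s\<close>, because the slab
  between two heights lies in a box that is thin in direction \<open>i\<close>. The intermediate value theorem then
  gives every proportion.\<close>

lemma bounded_set_split_in_proportion:
  fixes S :: "'a::euclidean_space set"
  assumes S: "S \<in> lmeasurable" "bounded S" and i: "i \<in> Basis" and p: "0 \<le> p" "p \<le> 1"
  shows "\<exists>s. measure lebesgue (S \<inter> {x. x \<bullet> i < s}) = p * measure lebesgue S"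
proof -
  obtain a where a: "S \<subseteq> cbox (-a) a" using bounded_subset_cbox_symmetric[OF S(2)] by blast
  define V where "V s = measure lebesgue (S \<inter> {x. x \<bullet> i < s})" for s
  define M where "M = (\<Prod>j\<in>Basis - {i}. 2 * \<bar>a \<bullet> j\<bar>)"
  have M0: "M \<ge> 0" unfolding M_def by (auto intro: prod_nonneg)
  have lip: "V s' - V s \<le> M * (s' - s)" "0 \<le> V s' - V s" if "s \<le> s'" for s s'
  proof -
    let ?T = "S \<inter> {x. x \<bullet> i < s'}"
    have T: "?T \<in> lmeasurable" using lmeasurable_Int_halfspace[OF S(1)] by blast
    have "?T \<inter> {x. x \<bullet> i < s} = S \<inter> {x. x \<bullet> i < s}" using that by auto
    then have eq: "V s' - V s = measure lebesgue (?T \<inter> {x. x \<bullet> i \<ge> s})"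
      using measure_split_halfspace[OF T, of i s] by (simp add: V_def)
    then show "0 \<le> V s' - V s" by simp
    let ?l = "\<Sum>j\<in>Basis. (if j = i then s else - \<bar>a \<bullet> j\<bar>) *\<^sub>R j"
    let ?u = "\<Sum>j\<in>Basis. (if j = i then s' else \<bar>a \<bullet> j\<bar>) *\<^sub>R j"
    have "?T \<inter> {x. x \<bullet> i \<ge> s} \<subseteq> cbox ?l ?u"
    proof
      fix x assume x: "x \<in> ?T \<inter> {x. x \<bullet> i \<ge> s}"
      then have "x \<in> cbox (-a) a" using a by blast
      then have "\<bar>x \<bullet> j\<bar> \<le> \<bar>a \<bullet> j\<bar>" if "j \<in> Basis" for j
        using that unfolding mem_box by fastforce
      then show "x \<in> cbox ?l ?u" using x unfolding mem_box by (fastforce simp: abs_le_iff)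
    qed
    then have "V s' - V s \<le> measure lebesgue (cbox ?l ?u)"
      unfolding eq using lmeasurable_Int_halfspace[OF T] by (intro measure_mono_fmeasurable) auto
    also have "\<dots> = (\<Prod>j\<in>Basis. ?u \<bullet> j - ?l \<bullet> j)"
      unfolding measure_completion[OF sets_lborel[THEN equalityD2, THEN subsetD, OF borel_closed[OF closed_cbox]]]
      by (rule content_cbox) (use that in auto)
    also have "\<dots> = M * (s' - s)"
      using i by (subst prod.remove[OF finite_Basis i]) (auto simp: M_def intro!: prod.cong)
    finally show "V s' - V s \<le> M * (s' - s)" .
  qed
  have "M-lipschitz_on UNIV V"
  proof (rule lipschitz_onI[OF _ M0])
    fix s s'
    show "dist (V s) (V s') \<le> M * dist s s'"
      using lip[of s s'] lip[of s' s] by (cases "s \<le> s'") (auto simp: dist_real_def abs_if)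
  qed
  then have cont: "continuous_on T V" for T
    using lipschitz_on_continuous_on continuous_on_subset by blast
  define N where "N = \<bar>a \<bullet> i\<bar> + 1"
  have N: "- N < x \<bullet> i \<and> x \<bullet> i < N" if "x \<in> S" for x
  proof -
    have "x \<in> cbox (-a) a" using a that by blast
    then show ?thesis using i unfolding mem_box N_def by force
  qed
  have "S \<inter> {x. x \<bullet> i < - N} = {}" "S \<inter> {x. x \<bullet> i < N} = S" using N by (force simp: not_less less_imp_le)+
  then have "V (-N) = 0" "V N = measure lebesgue S" by (simp_all add: V_def)
  then have "\<exists>s. -N \<le> s \<and> s \<le> N \<and> V s = p * measure lebesgue S"
    using p by (intro IVT' cont) (auto simp: N_def mult_left_le_one_le)
  then show ?thesis by (auto simp: V_def)
qed

text \<open>If no coordinate separates two nonempty boxes, then the componentwise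
  maximum of their lower corners lies in both.\<close>

lemma disjoint_half_open_boxes_separated:
  assumes "half_open_box a b \<inter> half_open_box a' b' = {}" "half_open_box a b \<noteq> {}" "half_open_box a' b' \<noteq> {}"
  shows "\<exists>i\<in>Basis. b \<bullet> i \<le> a' \<bullet> i \<or> b' \<bullet> i \<le> a \<bullet> i"
proof (rule ccontr)
  assume "\<not> ?thesis"
  then have "(\<Sum>i\<in>Basis. max (a \<bullet> i) (a' \<bullet> i) *\<^sub>R i) \<in> half_open_box a b \<inter> half_open_box a' b'"
    using assms(2,3) unfolding half_open_box_nonempty_iff by (auto simp: half_open_box_def)
  then show False using assms(1) by blast
qed

lemma box_partition_pos:
  assumes "box_partition \<A>" "\<A> \<noteq> {}"
  shows "measure lebesgue (\<Union>\<A>) > 0"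
proof -
  obtain K where K: "K \<in> \<A>" using assms(2) by blast
  then have "K \<in> lmeasurable"
    using assms(1) lmeasurable_half_open_box unfolding box_partition_def by metis
  then have "measure lebesgue K \<le> measure lebesgue (\<Union>\<A>)"
    using K box_partition_lmeasurable[OF assms(1)] by (intro measure_mono_fmeasurable) auto
  then show ?thesis using box_partition_member_pos[OF assms(1) K] by linarith
qed

lemma box_partition_members_separated:
  assumes "box_partition \<A>" "K \<in> \<A>" "L \<in> \<A>" "K \<noteq> L"
  obtains i s K' L' where "i \<in> Basis" "K' \<in> \<A>" "L' \<in> \<A>" "K' \<subseteq> {x. x \<bullet> i < s}" "L' \<subseteq> {x. x \<bullet> i \<ge> s}"
proof -
  obtain a b a' b' where ab: "K = half_open_box a b" "L = half_open_box a' b'" "K \<noteq> {}" "L \<noteq> {}"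
    using assms(1-3) unfolding box_partition_def by metis
  have "K \<inter> L = {}" using assms unfolding box_partition_def disjoint_def by blast
  then obtain i where i: "i \<in> Basis" "b \<bullet> i \<le> a' \<bullet> i \<or> b' \<bullet> i \<le> a \<bullet> i"
    using disjoint_half_open_boxes_separated ab by metis
  from i(2) show thesis
  proof
    assume "b \<bullet> i \<le> a' \<bullet> i"
    then have "K \<subseteq> {x. x \<bullet> i < a' \<bullet> i}" "L \<subseteq> {x. x \<bullet> i \<ge> a' \<bullet> i}"
      using i(1) by (force simp: ab half_open_box_def)+
    then show thesis using that i(1) assms by blast
  next
    assume "b' \<bullet> i \<le> a \<bullet> i"
    then have "L \<subseteq> {x. x \<bullet> i < a \<bullet> i}" "K \<subseteq> {x. x \<bullet> i \<ge> a \<bullet> i}"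
      using i(1) by (force simp: ab half_open_box_def)+
    then show thesis using that i(1) assms by blast
  qed
qed

section \<open>The Brunn-Minkowski inequality\<close>

text \<open>A hyperplane separates two boxes of \<open>\<A>\<close>. A parallel hyperplane
  cuts \<open>\<B>\<close> in the same proportion \<open>p\<close>, and the combined hyperplane cuts \<open>C\<close> so that lower parts combine into
  the lower part of \<open>C\<close> and upper parts into the upper part. As \<open>u + v = 1\<close>, the bounds for the two parts are
  \<open>p\<close> and \<open>1 - p\<close> times the desired one. Each part of \<open>\<A>\<close> has lost a box, and no part of \<open>\<B>\<close> has gained
  one.

  Stating the inequality for an arbitrary measurable superset \<open>C\<close> of the combination makes the
  induction hypothesis applicable to the two parts of \<open>C\<close>, which may exceed the combinations of the parts of
  \<open>\<A>\<close> and \<open>\<B>\<close>.\<close>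

lemma brunn_minkowski_bisection_step:
  fixes \<A> \<B> :: "'a::euclidean_space set set" and u v :: real
  assumes \<A>: "box_partition \<A>" and \<B>: "box_partition \<B>" "\<B> \<noteq> {}"
    and KL: "K \<in> \<A>" "L \<in> \<A>" "K \<noteq> L"
    and uv: "u \<ge> 0" "v \<ge> 0" "u + v = 1"
    and C: "C \<in> lmeasurable"
    and sub: "\<And>x y. x \<in> \<Union>\<A> \<Longrightarrow> y \<in> \<Union>\<B> \<Longrightarrow> u *\<^sub>R x + v *\<^sub>R y \<in> C"
    and IH: "\<And>\<A>' \<B>' :: 'a set set. \<And>C'. \<lbrakk>card \<A>' < card \<A>; card \<B>' \<le> card \<B>; box_partition \<A>'; box_partition \<B>';
        \<A>' \<noteq> {}; \<B>' \<noteq> {}; C' \<in> lmeasurable;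
        \<And>x y. x \<in> \<Union>\<A>' \<Longrightarrow> y \<in> \<Union>\<B>' \<Longrightarrow> u *\<^sub>R x + v *\<^sub>R y \<in> C'\<rbrakk>
      \<Longrightarrow> measure lebesgue (\<Union>\<A>') powr u * measure lebesgue (\<Union>\<B>') powr v \<le> measure lebesgue C'"
  shows "measure lebesgue (\<Union>\<A>) powr u * measure lebesgue (\<Union>\<B>) powr v \<le> measure lebesgue C"
proof -
  obtain i s K' L' where i: "i \<in> Basis" and KL': "K' \<in> \<A>" "L' \<in> \<A>"
    and sep: "K' \<subseteq> {x. x \<bullet> i < s}" "L' \<subseteq> {x. x \<bullet> i \<ge> s}"
    using box_partition_members_separated[OF \<A> KL] .
  have fin: "finite \<A>" "finite \<B>" and ne: "K' \<noteq> {}" "L' \<noteq> {}"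
    using \<A> \<B> KL' unfolding box_partition_def by auto
  let ?lt = "\<lambda>s. {x. x \<bullet> i < s}" and ?ge = "\<lambda>s. {x. x \<bullet> i \<ge> s}"
  let ?\<alpha> = "measure lebesgue (\<Union>\<A>)" and ?\<beta> = "measure lebesgue (\<Union>\<B>)"
  note part = box_partition_restrict_halfspace[OF \<A> i] box_partition_restrict_halfspace[OF \<B>(1) i]
  have neA: "restrict_partition \<A> (?lt s) \<noteq> {}" "restrict_partition \<A> (?ge s) \<noteq> {}"
    using KL' sep ne unfolding restrict_partition_def by blast+
  have \<alpha>: "?\<alpha> > 0" and \<beta>: "?\<beta> > 0"
    using box_partition_pos \<A> \<B> KL by blast+
  define p where "p = measure lebesgue (\<Union>\<A> \<inter> ?lt s) / ?\<alpha>"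
  have A1: "measure lebesgue (\<Union>\<A> \<inter> ?lt s) = p * ?\<alpha>" using \<alpha> by (simp add: p_def)
  then have A2: "measure lebesgue (\<Union>\<A> \<inter> ?ge s) = (1 - p) * ?\<alpha>"
    using measure_split_halfspace[OF box_partition_lmeasurable[OF \<A>], of i s] by (simp add: algebra_simps)
  have "p * ?\<alpha> > 0" "(1 - p) * ?\<alpha> > 0"
    using box_partition_pos[OF part(1) neA(1)] box_partition_pos[OF part(2) neA(2)]
    by (simp_all only: A1[symmetric] A2[symmetric] Union_restrict_partition)
  then have p: "0 < p" "p < 1" using \<alpha> by (simp_all add: zero_less_mult_iff)
  obtain s' where B1: "measure lebesgue (\<Union>\<B> \<inter> ?lt s') = p * ?\<beta>"
    using bounded_set_split_in_proportion[OF box_partition_lmeasurable[OF \<B>(1)]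
        box_partition_bounded[OF \<B>(1)] i, of p] p by auto
  then have B2: "measure lebesgue (\<Union>\<B> \<inter> ?ge s') = (1 - p) * ?\<beta>"
    using measure_split_halfspace[OF box_partition_lmeasurable[OF \<B>(1)], of i s'] by (simp add: algebra_simps)
  \<comment> \<open>Both parts of \<open>\<B>\<close> have positive volume, hence contain a box.\<close>
  have neB: "restrict_partition \<B> (?lt s') \<noteq> {}" "restrict_partition \<B> (?ge s') \<noteq> {}"
  proof -
    have "\<Union>\<B> \<inter> ?lt s' \<noteq> {}" using B1 p \<beta> by force
    then show "restrict_partition \<B> (?lt s') \<noteq> {}"
      by (metis Union_restrict_partition Union_empty)
    have "\<Union>\<B> \<inter> ?ge s' \<noteq> {}" using B2 p \<beta> by force
    then show "restrict_partition \<B> (?ge s') \<noteq> {}"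
      by (metis Union_restrict_partition Union_empty)
  qed
  let ?r = "u * s + v * s'"
  have scale: "(c * ?\<alpha>) powr u * (c * ?\<beta>) powr v = c * (?\<alpha> powr u * ?\<beta> powr v)" if "c > 0" for c
  proof -
    have "(c * ?\<alpha>) powr u * (c * ?\<beta>) powr v = (c powr u * c powr v) * (?\<alpha> powr u * ?\<beta> powr v)"
      using that \<alpha> \<beta> by (simp add: powr_mult)
    also have "c powr u * c powr v = c" using that uv by (simp add: powr_add[symmetric])
    finally show ?thesis .
  qed
  have "measure lebesgue (\<Union>(restrict_partition \<A> (?lt s))) powr u *
      measure lebesgue (\<Union>(restrict_partition \<B> (?lt s'))) powr v \<le> measure lebesgue (C \<inter> ?lt ?r)"
  proof (rule IH)
    have "L' \<inter> ?lt s = {}" using sep by fastforce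
    then show "card (restrict_partition \<A> (?lt s)) < card \<A>"
      by (rule card_restrict_partition_less[OF fin(1) KL'(2)])
    fix x y assume "x \<in> \<Union>(restrict_partition \<A> (?lt s))" "y \<in> \<Union>(restrict_partition \<B> (?lt s'))"
    then have xy: "x \<in> \<Union>\<A>" "y \<in> \<Union>\<B>" "x \<bullet> i < s" "y \<bullet> i < s'"
      unfolding Union_restrict_partition by blast+
    have "u * (x \<bullet> i) + v * (y \<bullet> i) < ?r"
    proof (cases "u = 0")
      case True then show ?thesis using uv xy by simp
    next
      case False
      then have "u * (x \<bullet> i) < u * s" using uv xy by simp
      moreover have "v * (y \<bullet> i) \<le> v * s'" using uv xy by (simp add: mult_left_mono)
      ultimately show ?thesis by linarith
    qed
    then show "u *\<^sub>R x + v *\<^sub>R y \<in> C \<inter> ?lt ?r" using sub xy by (simp add: inner_add_left)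
  qed (rule part neA neB card_restrict_partition_le[OF fin(2)] lmeasurable_Int_halfspace[OF C])+
  moreover have "measure lebesgue (\<Union>(restrict_partition \<A> (?ge s))) powr u *
      measure lebesgue (\<Union>(restrict_partition \<B> (?ge s'))) powr v \<le> measure lebesgue (C \<inter> ?ge ?r)"
  proof (rule IH)
    have "K' \<inter> ?ge s = {}" using sep by fastforce
    then show "card (restrict_partition \<A> (?ge s)) < card \<A>"
      by (rule card_restrict_partition_less[OF fin(1) KL'(1)])
    fix x y assume "x \<in> \<Union>(restrict_partition \<A> (?ge s))" "y \<in> \<Union>(restrict_partition \<B> (?ge s'))"
    then have xy: "x \<in> \<Union>\<A>" "y \<in> \<Union>\<B>" "x \<bullet> i \<ge> s" "y \<bullet> i \<ge> s'"
      unfolding Union_restrict_partition by blast+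
    have "u * (x \<bullet> i) + v * (y \<bullet> i) \<ge> ?r"
      using uv xy by (intro add_mono mult_left_mono)
    then show "u *\<^sub>R x + v *\<^sub>R y \<in> C \<inter> ?ge ?r" using sub xy by (simp add: inner_add_left)
  qed (rule part neA neB card_restrict_partition_le[OF fin(2)] lmeasurable_Int_halfspace[OF C])+
  ultimately have "p * (?\<alpha> powr u * ?\<beta> powr v) + (1 - p) * (?\<alpha> powr u * ?\<beta> powr v)
      \<le> measure lebesgue (C \<inter> ?lt ?r) + measure lebesgue (C \<inter> ?ge ?r)"
    unfolding Union_restrict_partition A1 A2 B1 B2 using scale[of p] scale[of "1 - p"] p by simp
  also have "\<dots> = measure lebesgue C" using measure_split_halfspace[OF C] by metis
  finally show ?thesis by (simp add: algebra_simps)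
qed

text \<open>Exchanging the two families together with their weights lets the bisection act on
  whichever family has at least two boxes.\<close>

lemma brunn_minkowski_box_partition:
  fixes \<A> \<B> :: "'a::euclidean_space set set" and u v :: real
  assumes "box_partition \<A>" "box_partition \<B>" "\<A> \<noteq> {}" "\<B> \<noteq> {}"
    and "u \<ge> 0" "v \<ge> 0" "u + v = 1" "C \<in> lmeasurable"
    and "\<And>x y. x \<in> \<Union>\<A> \<Longrightarrow> y \<in> \<Union>\<B> \<Longrightarrow> u *\<^sub>R x + v *\<^sub>R y \<in> C"
  shows "measure lebesgue (\<Union>\<A>) powr u * measure lebesgue (\<Union>\<B>) powr v \<le> measure lebesgue C"
  using assms
proof (induction "card \<A> + card \<B>" arbitrary: \<A> \<B> u v C rule: less_induct)
  case less
  have swap: "v *\<^sub>R y + u *\<^sub>R x \<in> C" if "x \<in> \<Union>\<A>" "y \<in> \<Union>\<B>" for x y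
    using less.prems(9)[OF that] by (simp add: add.commute)
  have vu: "v + u = 1" using less.prems(7) by simp
  consider (A) K L where "K \<in> \<A>" "L \<in> \<A>" "K \<noteq> L" | (B) K L where "K \<in> \<B>" "L \<in> \<B>" "K \<noteq> L"
    | (single) K L where "\<A> = {K}" "\<B> = {L}"
  proof -
    obtain K L where "K \<in> \<A>" "L \<in> \<B>" using less.prems(3,4) by blast
    then have "(\<exists>K'\<in>\<A>. K' \<noteq> K) \<or> \<A> = {K}" "(\<exists>L'\<in>\<B>. L' \<noteq> L) \<or> \<B> = {L}" by blast+
    then show thesis using that \<open>K \<in> \<A>\<close> \<open>L \<in> \<B>\<close> by metis
  qed
  then show ?case
  proof cases
    case A
    show ?thesis
    proof (rule brunn_minkowski_bisection_step[OF less.prems(1,2,4) A less.prems(5-9)])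
      fix \<A>' \<B>' :: "'a set set" and C'
      assume *: "card \<A>' < card \<A>" "card \<B>' \<le> card \<B>" "box_partition \<A>'" "box_partition \<B>'"
        "\<A>' \<noteq> {}" "\<B>' \<noteq> {}" "C' \<in> lmeasurable"
        "\<And>x y. x \<in> \<Union>\<A>' \<Longrightarrow> y \<in> \<Union>\<B>' \<Longrightarrow> u *\<^sub>R x + v *\<^sub>R y \<in> C'"
      have "card \<A>' + card \<B>' < card \<A> + card \<B>" using *(1,2) by linarith
      from less.hyps[OF this *(3-6) less.prems(5-7) *(7,8)]
      show "measure lebesgue (\<Union>\<A>') powr u * measure lebesgue (\<Union>\<B>') powr v \<le> measure lebesgue C'" .
    qed
  next
    case B
    have "measure lebesgue (\<Union>\<B>) powr v * measure lebesgue (\<Union>\<A>) powr u \<le> measure lebesgue C"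
    proof (rule brunn_minkowski_bisection_step[OF less.prems(2,1,3) B less.prems(6,5) vu less.prems(8)])
      show "v *\<^sub>R y + u *\<^sub>R x \<in> C" if "y \<in> \<Union>\<B>" "x \<in> \<Union>\<A>" for x y
        using swap that by blast
      fix \<B>' \<A>' :: "'a set set" and C'
      assume *: "card \<B>' < card \<B>" "card \<A>' \<le> card \<A>" "box_partition \<B>'" "box_partition \<A>'"
        "\<B>' \<noteq> {}" "\<A>' \<noteq> {}" "C' \<in> lmeasurable"
        "\<And>x y. x \<in> \<Union>\<B>' \<Longrightarrow> y \<in> \<Union>\<A>' \<Longrightarrow> v *\<^sub>R x + u *\<^sub>R y \<in> C'"
      have "card \<B>' + card \<A>' < card \<A> + card \<B>" using *(1,2) by linarith
      from less.hyps[OF this *(3-6) less.prems(6,5) vu *(7,8)]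
      show "measure lebesgue (\<Union>\<B>') powr v * measure lebesgue (\<Union>\<A>') powr u \<le> measure lebesgue C'" .
    qed
    then show ?thesis by (simp add: mult.commute)
  next
    case single
    obtain a b where K: "K = half_open_box a b" "K \<noteq> {}"
      using less.prems(1) single(1) unfolding box_partition_def by auto
    obtain a' b' where L: "L = half_open_box a' b'" "L \<noteq> {}"
      using less.prems(2) single(2) unfolding box_partition_def by auto
    have "measure lebesgue K powr u * measure lebesgue L powr v \<le> measure lebesgue C"
      using less.prems(9) K(2) L(2) unfolding K(1) L(1) single
      by (intro brunn_minkowski_half_open_box less.prems(5-8)) simp_all
    then show ?thesis by (simp add: single)
  qed
qed

text \<open>The covering lemma tiles an open set by countably many closed boxes with
  disjoint interiors; finitely many of them exhaust the volume up to any error. Turning them into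
  half-open boxes makes them disjoint and changes them by null sets only.\<close>

lemma open_set_inner_box_partition:
  fixes S :: "'a::euclidean_space set"
  assumes "open S" "bounded S" "m < measure lebesgue S"
  shows "\<exists>\<A>. box_partition \<A> \<and> \<Union>\<A> \<subseteq> S \<and> m < measure lebesgue (\<Union>\<A>)"
proof -
  have Sm: "S \<in> lmeasurable" using assms by (simp add: lmeasurable_open)
  obtain c where c: "S \<subseteq> box (-c) c" using bounded_subset_box_symmetric[OF assms(2)] by blast
  show ?thesis
  proof (cases "S = {}")
    case True
    then have "box_partition {} \<and> \<Union>{} \<subseteq> S \<and> m < measure lebesgue (\<Union>{})"
      using assms(3) by (simp add: box_partition_def)
    then show ?thesis by blast
  next
    case False
    then have ne: "box (-c) c \<noteq> {}" using c by blast
    \<comment> \<open>This gauge forces every tile of the covering lemma into \<open>S\<close>.\<close>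
    define g where "g x = (if x \<in> S then S else UNIV)" for x
    have g: "gauge g" using assms(1) unfolding gauge_def g_def by simp
    have "S \<subseteq> cbox (-c) c" using c box_subset_cbox by blast
    from covering_lemma[OF this ne g] obtain \<D> where
      D: "countable \<D>" "\<And>K. K \<in> \<D> \<Longrightarrow> interior K \<noteq> {} \<and> (\<exists>c d. K = cbox c d)"
        "pairwise (\<lambda>A B. interior A \<inter> interior B = {}) \<D>"
        "\<And>K. K \<in> \<D> \<Longrightarrow> \<exists>x \<in> S \<inter> K. K \<subseteq> g x" "S \<subseteq> \<Union>\<D>"
      by metis
    have KS: "K \<subseteq> S" if K: "K \<in> \<D>" for K
    proof -
      obtain x where "x \<in> S" "K \<subseteq> g x" using D(4)[OF K] by blast
      then show ?thesis by (simp add: g_def)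
    qed
    then have DS: "\<Union>\<D> = S" using D(5) by blast
    obtain \<F> where F: "finite \<F>" "\<F> \<subseteq> \<D>" "m < measure lebesgue (\<Union>\<F>)"
    proof (rule measure_countable_Union_approachable[OF D(1), of "measure lebesgue S - m" "measure lebesgue S"])
      show "K \<in> lmeasurable" if "K \<in> \<D>" for K using D(2)[OF that] by auto
      then have "\<Union>\<F> \<in> lmeasurable" if "\<F> \<subseteq> \<D>" "finite \<F>" for \<F>
        using that by (simp add: fmeasurable.finite_Union subset_iff)
      moreover have "\<Union>\<F> \<subseteq> S" if "\<F> \<subseteq> \<D>" for \<F> using that KS by blast
      ultimately show "measure lebesgue (\<Union>\<F>) \<le> measure lebesgue S" if "\<F> \<subseteq> \<D>" "finite \<F>" for \<F>
        using that by (intro measure_mono_fmeasurable fmeasurableD Sm)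
    qed (use assms(3) DS that in auto)
    obtain l h where lh: "\<And>K. K \<in> \<D> \<Longrightarrow> K = cbox (l K) (h K)" using D(2) by metis
    define H where "H K = half_open_box (l K) (h K)" for K
    have HK: "H K \<subseteq> K" if "K \<in> \<D>" for K
    proof
      fix x assume "x \<in> H K"
      then have "x \<in> cbox (l K) (h K)"
        unfolding H_def half_open_box_def mem_box mem_Collect_eq by (meson less_imp_le)
      then show "x \<in> K" using lh[OF that] by simp
    qed
    have Hne: "H K \<noteq> {}" if "K \<in> \<D>" for K
    proof -
      have "box (l K) (h K) \<noteq> {}" using D(2)[OF that] lh[OF that] by (metis interior_cbox)
      then show ?thesis unfolding H_def half_open_box_nonempty_iff box_ne_empty .
    qed
    have Hdisj: "H K \<inter> H L = {}" if "K \<in> \<D>" "L \<in> \<D>" "K \<noteq> L" for K L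
    proof (rule ccontr)
      assume "H K \<inter> H L \<noteq> {}"
      then obtain x where x: "x \<in> H K" "x \<in> H L" by blast
      have "box (l K) (h K) \<inter> box (l L) (h L) = {}"
        using D(3) that lh[OF that(1)] lh[OF that(2)] unfolding pairwise_def by (metis interior_cbox)
      then obtain i where "i \<in> Basis" "h K \<bullet> i \<le> l K \<bullet> i \<or> h L \<bullet> i \<le> l L \<bullet> i \<or> h K \<bullet> i \<le> l L \<bullet> i \<or> h L \<bullet> i \<le> l K \<bullet> i"
        unfolding disjoint_interval by metis
      moreover from this(1) have "l K \<bullet> i \<le> x \<bullet> i" "x \<bullet> i < h K \<bullet> i" "l L \<bullet> i \<le> x \<bullet> i" "x \<bullet> i < h L \<bullet> i"
        using x unfolding H_def half_open_box_def by simp_all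
      ultimately show False by linarith
    qed
    have "box_partition (H ` \<F>)"
      unfolding box_partition_def
    proof (intro conjI ballI)
      show "disjoint (H ` \<F>)" using Hdisj F(2) unfolding disjoint_def by blast
      show "K \<noteq> {}" if "K \<in> H ` \<F>" for K using that Hne F(2) by blast
      show "\<exists>a b. K = half_open_box a b" if "K \<in> H ` \<F>" for K using that unfolding H_def by blast
    qed (use F in simp)
    moreover have "\<Union>(H ` \<F>) \<subseteq> S" using HK DS F(2) by blast
    moreover have "m < measure lebesgue (\<Union>(H ` \<F>))"
    proof -
      have Fm: "\<Union>\<F> \<in> lmeasurable"
      proof (rule fmeasurable.finite_Union[OF F(1)], rule subsetI)
        fix K assume "K \<in> \<F>"
        then have "K = cbox (l K) (h K)" using lh F(2) by blast
        then show "K \<in> lmeasurable" by (metis lmeasurable_cbox)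
      qed
      have "negligible (\<Union>K\<in>\<F>. cbox (l K) (h K) - H K \<union> (H K - cbox (l K) (h K)))"
        unfolding H_def using F(1) by (intro negligible_Union) (auto simp only: finite_imageI negligible_symdiff_half_open_box)
      then have "negligible (\<Union>\<F> - \<Union>(H ` \<F>) \<union> (\<Union>(H ` \<F>) - \<Union>\<F>))"
      proof (rule negligible_subset)
        have "K = cbox (l K) (h K)" if "K \<in> \<F>" for K using lh that F(2) by blast
        then show "\<Union>\<F> - \<Union>(H ` \<F>) \<union> (\<Union>(H ` \<F>) - \<Union>\<F>)
            \<subseteq> (\<Union>K\<in>\<F>. cbox (l K) (h K) - H K \<union> (H K - cbox (l K) (h K)))" by auto
      qed
      from measure_negligible_symdiff[OF Fm this] show ?thesis using F(3) by simp
    qed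
    ultimately show ?thesis by blast
  qed
qed

text \<open>The bound holds for inner approximations of relative volume \<open>r < 1\<close>, hence in the limit
  \<open>r \<longlongrightarrow> 1\<close>.\<close>

theorem brunn_minkowski_open:
  fixes A B :: "'a::euclidean_space set" and u v :: real
  assumes A: "open A" "bounded A" "A \<noteq> {}" and B: "open B" "bounded B" "B \<noteq> {}"
    and uv: "u \<ge> 0" "v \<ge> 0" "u + v = 1" and C: "C \<in> lmeasurable"
    and sub: "\<And>x y. x \<in> A \<Longrightarrow> y \<in> B \<Longrightarrow> u *\<^sub>R x + v *\<^sub>R y \<in> C"
  shows "measure lebesgue A powr u * measure lebesgue B powr v \<le> measure lebesgue C"
proof -
  let ?\<alpha> = "measure lebesgue A" and ?\<beta> = "measure lebesgue B"
  have pos: "measure lebesgue S > 0" if "open S" "bounded S" "S \<noteq> {}" for S :: "'a set"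
    using open_not_negligible[OF that(1,3)] negligible_iff_measure0[OF lmeasurable_open[OF that(2,1)]]
    by (simp add: zero_less_measure_iff)
  have \<alpha>: "?\<alpha> > 0" and \<beta>: "?\<beta> > 0" using pos A B by blast+
  have *: "(r * ?\<alpha>) powr u * (r * ?\<beta>) powr v \<le> measure lebesgue C" if r: "0 < r" "r < 1" for r
  proof -
    have "r * ?\<alpha> < ?\<alpha>" "r * ?\<beta> < ?\<beta>" using r \<alpha> \<beta> by simp_all
    then obtain \<A> \<B> where
      part: "box_partition \<A>" "\<Union>\<A> \<subseteq> A" "r * ?\<alpha> < measure lebesgue (\<Union>\<A>)"
      "box_partition \<B>" "\<Union>\<B> \<subseteq> B" "r * ?\<beta> < measure lebesgue (\<Union>\<B>)"
      using open_set_inner_box_partition A(1,2) B(1,2) by metis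
    have "0 < r * ?\<alpha>" "0 < r * ?\<beta>" using r \<alpha> \<beta> by simp_all
    then have "\<A> \<noteq> {}" "\<B> \<noteq> {}" using part(3,6) by force+
    then have "measure lebesgue (\<Union>\<A>) powr u * measure lebesgue (\<Union>\<B>) powr v \<le> measure lebesgue C"
      using part sub by (intro brunn_minkowski_box_partition uv C) blast+
    moreover have "(r * ?\<alpha>) powr u * (r * ?\<beta>) powr v
        \<le> measure lebesgue (\<Union>\<A>) powr u * measure lebesgue (\<Union>\<B>) powr v"
      using part(3,6) \<open>0 < r * ?\<alpha>\<close> \<open>0 < r * ?\<beta>\<close> uv by (intro mult_mono powr_mono2) auto
    ultimately show ?thesis by linarith
  qed
  have "((\<lambda>r. (r * ?\<alpha>) powr u * (r * ?\<beta>) powr v) \<longlongrightarrow> (1 * ?\<alpha>) powr u * (1 * ?\<beta>) powr v) (at_left 1)"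
    using \<alpha> \<beta> by (intro tendsto_intros) auto
  moreover have "\<forall>\<^sub>F r in at_left (1::real). (r * ?\<alpha>) powr u * (r * ?\<beta>) powr v \<le> measure lebesgue C"
    using eventually_at_left_real[of 0 1] * by (auto elim!: eventually_mono)
  ultimately have "(1 * ?\<alpha>) powr u * (1 * ?\<beta>) powr v \<le> measure lebesgue C"
    by (rule tendsto_upperbound) simp
  then show ?thesis by simp
qed

section \<open>Caps of convex bodies\<close>

definition cap_volume :: "'a::euclidean_space set \<Rightarrow> 'a \<Rightarrow> real \<Rightarrow> real" where
  "cap_volume K w s = measure lebesgue (K \<inter> {x. x \<bullet> w \<le> s})"

lemma negligible_level_set: "w \<noteq> 0 \<Longrightarrow> negligible {x::'a::euclidean_space. x \<bullet> w = s}"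
  using negligible_hyperplane[of w s] by (simp add: inner_commute)

lemma convex_body_lmeasurable: "convex_body K \<Longrightarrow> K \<in> lmeasurable"
  unfolding convex_body_def by (simp add: lmeasurable_compact)

lemma convex_body_measure_pos:
  assumes "convex_body K"
  shows "measure lebesgue K > 0"
proof -
  have "\<not> negligible (interior K)"
    using assms unfolding convex_body_def by (intro open_not_negligible) auto
  then have "\<not> negligible K" using negligible_subset[OF _ interior_subset] by blast
  then show ?thesis
    using negligible_iff_measure0[OF convex_body_lmeasurable[OF assms]] by (simp add: zero_less_measure_iff)
qed

text \<open>A convex body is the closure of its interior, so an open half-space that meets the body
  also meets the interior.\<close>

lemma convex_body_open_cap_nonempty:
  fixes K :: "'a::euclidean_space set"
  assumes K: "convex_body K" and y: "y \<in> K" "y \<bullet> w < s"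
  shows "interior K \<inter> {x. x \<bullet> w < s} \<noteq> {}"
proof -
  have "open {x. x \<bullet> w < s}" by (intro open_Collect_less continuous_intros)
  moreover have "y \<in> closure (interior K)"
    using convex_closure_interior[of K] K y(1) closure_subset[of K] unfolding convex_body_def by auto
  ultimately have "{x. x \<bullet> w < s} \<inter> interior K \<noteq> {}"
    using open_Int_closure_eq_empty[of "{x. x \<bullet> w < s}" "interior K"] y(2) by blast
  then show ?thesis by (simp add: Int_commute)
qed

lemma convex_body_cap:
  fixes K :: "'a::euclidean_space set"
  assumes K: "convex_body K" and y: "y \<in> K" "y \<bullet> w < s"
  shows "convex_body (K \<inter> {x. x \<bullet> w \<le> s})"
  unfolding convex_body_def
proof (intro conjI)
  have "closed {x. x \<bullet> w \<le> s}" by (intro closed_Collect_le continuous_intros)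
  then show "compact (K \<inter> {x. x \<bullet> w \<le> s})"
    using K unfolding convex_body_def by (simp add: compact_Int_closed)
  have "convex {x. x \<bullet> w \<le> s}" using convex_halfspace_le[of w s] by (simp add: inner_commute)
  then show "convex (K \<inter> {x. x \<bullet> w \<le> s})"
    using K unfolding convex_body_def by (simp add: convex_Int)
  have "open {x. x \<bullet> w < s}" by (intro open_Collect_less continuous_intros)
  then have "interior K \<inter> {x. x \<bullet> w < s} \<subseteq> interior (K \<inter> {x. x \<bullet> w \<le> s})"
    using interior_subset[of K] by (intro interior_maximal) (auto intro: less_imp_le)
  then show "interior (K \<inter> {x. x \<bullet> w \<le> s}) \<noteq> {}"
    using convex_body_open_cap_nonempty[OF K y] by blast
qed

text \<open>The Brunn-Minkowski inequality is available for open sets. Passing to the open cap loses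
  part of the frontier of \<open>K\<close> and part of a hyperplane, both of them null sets.\<close>

lemma measure_open_cap:
  fixes K :: "'a::euclidean_space set"
  assumes K: "convex_body K" and w: "w \<noteq> 0"
  shows "measure lebesgue (interior K \<inter> {x. x \<bullet> w < s}) = cap_volume K w s"
  unfolding cap_volume_def
proof (rule measure_negligible_symdiff)
  show "K \<inter> {x. x \<bullet> w \<le> s} \<in> lmeasurable"
    by (rule lmeasurable_Int_halfspace(3)[OF convex_body_lmeasurable[OF K]])
  have "negligible (frontier K \<union> {x. x \<bullet> w = s})"
    using K unfolding convex_body_def by (intro negligible_Un negligible_convex_frontier negligible_level_set[OF w]) simp
  then show "negligible (K \<inter> {x. x \<bullet> w \<le> s} - interior K \<inter> {x. x \<bullet> w < s} \<union>
      (interior K \<inter> {x. x \<bullet> w < s} - K \<inter> {x. x \<bullet> w \<le> s}))"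
  proof (rule negligible_subset)
    have "interior K \<subseteq> K" "K \<subseteq> frontier K \<union> interior K"
      using interior_subset closure_subset[of K] by (auto simp: frontier_def)
    then show "K \<inter> {x. x \<bullet> w \<le> s} - interior K \<inter> {x. x \<bullet> w < s} \<union>
      (interior K \<inter> {x. x \<bullet> w < s} - K \<inter> {x. x \<bullet> w \<le> s}) \<subseteq> frontier K \<union> {x. x \<bullet> w = s}"
      by auto
  qed
qed

text \<open>By convexity of \<open>K\<close>, the combination of the caps at heights \<open>s\<close> and \<open>s'\<close> lies in the cap
  at the combined height.\<close>

lemma cap_volume_log_concave:
  fixes K :: "'a::euclidean_space set" and u v :: real
  assumes K: "convex_body K" and w: "w \<noteq> 0"
    and y: "y \<in> K" "y \<bullet> w < s" "y \<bullet> w < s'"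
    and uv: "u \<ge> 0" "v \<ge> 0" "u + v = 1"
  shows "cap_volume K w s powr u * cap_volume K w s' powr v \<le> cap_volume K w (u * s + v * s')"
proof -
  let ?A = "\<lambda>s. interior K \<inter> {x. x \<bullet> w < s}" and ?C = "K \<inter> {x. x \<bullet> w \<le> u * s + v * s'}"
  have op: "open (?A r)" for r by (intro open_Int open_interior open_Collect_less continuous_intros)
  have "bounded K" using K unfolding convex_body_def by (simp add: compact_imp_bounded)
  then have bd: "bounded (?A r)" for r by (rule bounded_subset[OF _ le_infI1[OF interior_subset]])
  have C: "?C \<in> lmeasurable" by (rule lmeasurable_Int_halfspace(3)[OF convex_body_lmeasurable[OF K]])
  have "u *\<^sub>R x + v *\<^sub>R z \<in> ?C" if "x \<in> ?A s" "z \<in> ?A s'" for x z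
  proof -
    have "x \<in> K" "z \<in> K" "x \<bullet> w \<le> s" "z \<bullet> w \<le> s'" using that interior_subset[of K] by auto
    then have "u *\<^sub>R x + v *\<^sub>R z \<in> K" "u * (x \<bullet> w) + v * (z \<bullet> w) \<le> u * s + v * s'"
      using K uv unfolding convex_body_def by (auto intro!: convexD add_mono mult_left_mono)
    then show ?thesis by (simp add: inner_add_left)
  qed
  from brunn_minkowski_open[OF op bd convex_body_open_cap_nonempty[OF K y(1,2)]
      op bd convex_body_open_cap_nonempty[OF K y(1,3)] uv C this]
  show ?thesis unfolding measure_open_cap[OF K w] by (simp only: cap_volume_def)
qed

section \<open>The center of gravity and Gruenbaum's theorem\<close>

lemma integrable_affine_on_compact:
  fixes K :: "'a::euclidean_space set"
  assumes "compact K"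
  shows "integrable lborel (\<lambda>x. indicator K x * (r + x \<bullet> w))"
  using borel_integrable_compact[OF assms, of "\<lambda>x. r + x \<bullet> w"] by (simp add: continuous_intros)

lemma integral_affine_eq_center_of_gravity:
  fixes K :: "'a::euclidean_space set"
  assumes K: "convex_body K"
  shows "(LINT x|lborel. indicator K x * (r + x \<bullet> w)) = measure lebesgue K * (r + center_of_gravity K \<bullet> w)"
proof -
  have c: "compact K" using K by (simp add: convex_body_def)
  have Kb: "K \<in> sets borel" using c by (simp add: borel_compact)
  have fin: "emeasure lborel K < \<infinity>"
    by (rule emeasure_bounded_finite[OF compact_imp_bounded[OF c]])
  have int: "integrable lborel (\<lambda>x. indicator K x *\<^sub>R x)"
    using borel_integrable_compact[OF c, of "\<lambda>x. x"] by (simp add: continuous_intros)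
  have intK: "integrable lborel (\<lambda>x. indicator K x * r)"
    using integrable_real_mult_indicator[of K lborel "\<lambda>_. r"] Kb fin by simp
  have "(LINT x:K|lebesgue. x) = (LINT x|lborel. indicator K x *\<^sub>R x)"
    unfolding set_lebesgue_integral_def using borel_measurable_integrable[OF int]
    by (simp add: integral_completion)
  then have cog: "measure lebesgue K *\<^sub>R center_of_gravity K = (LINT x|lborel. indicator K x *\<^sub>R x)"
    using convex_body_measure_pos[OF K] by (simp add: center_of_gravity_def)
  have "(LINT x|lborel. indicator K x * (r + x \<bullet> w))
      = (LINT x|lborel. indicator K x * r + (indicator K x *\<^sub>R x) \<bullet> w)"
    by (simp add: algebra_simps)
  also have "\<dots> = (LINT x|lborel. indicator K x * r) + (LINT x|lborel. (indicator K x *\<^sub>R x) \<bullet> w)"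
    by (rule Bochner_Integration.integral_add[OF intK integrable_inner_left[OF int]])
  also have "(LINT x|lborel. (indicator K x *\<^sub>R x) \<bullet> w) = measure lebesgue K *\<^sub>R center_of_gravity K \<bullet> w"
    unfolding cog using int by (subst integral_inner_left) auto
  also have "(LINT x|lborel. indicator K x * r) = measure lebesgue K * r"
    using Kb fin by simp
  finally show ?thesis by (simp add: algebra_simps)
qed

text \<open>The average of \<open>x \<bullet> w\<close> over \<open>K\<close> is its value at the center of gravity. If no
  value is below the average, then almost all are equal to it, and \<open>K\<close> is contained in a hyperplane up to a
  null set.\<close>

lemma convex_body_point_below_center_of_gravity:
  fixes K :: "'a::euclidean_space set"
  assumes K: "convex_body K" and w: "w \<noteq> 0"
  shows "\<exists>y\<in>K. y \<bullet> w < center_of_gravity K \<bullet> w"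
proof (rule ccontr)
  let ?m = "center_of_gravity K \<bullet> w"
  assume neg: "\<not> ?thesis"
  have c: "compact K" using K by (simp add: convex_body_def)
  let ?f = "\<lambda>x. indicator K x * (- ?m + x \<bullet> w)"
  have "integral\<^sup>L lborel ?f = 0"
    unfolding integral_affine_eq_center_of_gravity[OF K] by simp
  moreover have "AE x in lborel. 0 \<le> ?f x"
    using neg by (intro AE_I2) (auto simp: indicator_def not_less)
  ultimately have "AE x in lborel. ?f x = 0"
    using iffD1[OF integral_nonneg_eq_0_iff_AE[OF integrable_affine_on_compact[OF c]]] by blast
  then have "AE x in lebesgue. ?f x = 0" by (rule AE_completion)
  from AE_E3[OF this] obtain N where N: "N \<in> null_sets lebesgue" "\<And>x. x \<in> space lebesgue - N \<Longrightarrow> ?f x = 0"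
    by blast
  have "K \<subseteq> N \<union> {x. x \<bullet> w = ?m}" using N(2) by (force simp: indicator_def)
  moreover have "negligible (N \<union> {x. x \<bullet> w = ?m})"
    using N(1) negligible_level_set[OF w] by (intro negligible_Un) (simp_all only: negligible_iff_null_sets)
  ultimately have "negligible K" by (rule negligible_subset[rotated])
  then show False
    using convex_body_measure_pos[OF K] negligible_imp_measure0 by fastforce
qed

text \<open>Layer-cake formula: the positive part of \<open>b - x \<bullet> w\<close> is the length of the
  interval \<open>{x \<bullet> w..b}\<close>, and exchanging the order of integration collects, at each height \<open>s \<le> b\<close>, the points
  of \<open>K\<close> with \<open>x \<bullet> w \<le> s\<close>.\<close>

lemma integral_affine_le_integral_cap_volume:
  fixes K :: "'a::euclidean_space set"
  assumes c: "compact K" and low: "\<And>x. x \<in> K \<Longrightarrow> a \<le> x \<bullet> w"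
    and r: "r \<ge> 0" and bound: "(\<integral>\<^sup>+s. ennreal (cap_volume K w s) * indicator {a..b} s \<partial>lborel) \<le> ennreal r"
  shows "(LINT x|lborel. indicator K x * (b - x \<bullet> w)) \<le> r"
proof (rule integral_real_bounded[OF r])
  define G :: "'a \<Rightarrow> real \<Rightarrow> ennreal" where "G x s = indicator {p. fst p \<in> K \<and> fst p \<bullet> w \<le> snd p \<and> snd p \<le> b} (x, s)" for x s
  have G_eq: "G x s = indicator K x * indicator {x \<bullet> w..b} s" for x s
    by (simp add: G_def indicator_def)
  have "closed (fst -` K \<inter> {p::'a \<times> real. fst p \<bullet> w \<le> snd p \<and> snd p \<le> b})"
    using compact_imp_closed[OF c]
    by (intro closed_Int closed_vimage closed_Collect_conj closed_Collect_le continuous_intros)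
  then have "{p. fst p \<in> K \<and> fst p \<bullet> w \<le> snd p \<and> snd p \<le> b} \<in> sets (borel :: ('a \<times> real) measure)"
    by (intro borel_closed) (simp add: vimage_def Int_def conj_assoc)
  then have meas: "case_prod G \<in> borel_measurable (lborel \<Otimes>\<^sub>M lborel)"
    by (simp add: G_def lborel_prod split_def)
  have "(\<integral>\<^sup>+x. ennreal (indicator K x * (b - x \<bullet> w)) \<partial>lborel) \<le> (\<integral>\<^sup>+x. \<integral>\<^sup>+s. G x s \<partial>lborel \<partial>lborel)"
  proof (rule nn_integral_mono)
    fix x :: 'a
    have "(\<integral>\<^sup>+s. G x s \<partial>lborel) = indicator K x * ennreal (if x \<bullet> w \<le> b then b - x \<bullet> w else 0)"
      unfolding G_eq by (simp add: nn_integral_cmult)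
    then show "ennreal (indicator K x * (b - x \<bullet> w)) \<le> (\<integral>\<^sup>+s. G x s \<partial>lborel)"
      by (auto simp: indicator_def ennreal_neg)
  qed
  also have "\<dots> = (\<integral>\<^sup>+s. \<integral>\<^sup>+x. G x s \<partial>lborel \<partial>lborel)"
    by (rule lborel_pair.Fubini'[OF meas, symmetric])
  also have "\<dots> = (\<integral>\<^sup>+s. ennreal (cap_volume K w s) * indicator {a..b} s \<partial>lborel)"
  proof (rule nn_integral_cong)
    fix s :: real
    let ?T = "K \<inter> {x. x \<bullet> w \<le> s}"
    have T: "compact ?T"
      using c by (intro compact_Int_closed closed_Collect_le continuous_intros)
    have "(\<integral>\<^sup>+x. G x s \<partial>lborel) = (\<integral>\<^sup>+x. indicator {..b} s * indicator ?T x \<partial>lborel)"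
      by (intro nn_integral_cong) (auto simp: G_eq indicator_def)
    also have "\<dots> = indicator {..b} s * emeasure lborel ?T"
      using T by (intro nn_integral_cmult_indicator) (simp add: borel_compact)
    also have "emeasure lborel ?T = ennreal (cap_volume K w s)"
      using T emeasure_bounded_finite[OF compact_imp_bounded[OF T]]
      by (simp add: cap_volume_def borel_compact emeasure_eq_ennreal_measure)
    also have "indicator {..b} s * ennreal (cap_volume K w s) = ennreal (cap_volume K w s) * indicator {a..b} s"
    proof (cases "a \<le> s")
      case False
      then have "?T = {}" using low by force
      then show ?thesis using False by (simp add: cap_volume_def)
    qed (simp add: indicator_def)
    finally show "(\<integral>\<^sup>+x. G x s \<partial>lborel) = ennreal (cap_volume K w s) * indicator {a..b} s" .
  qed
  finally show "(\<integral>\<^sup>+x. ennreal (indicator K x * (b - x \<bullet> w)) \<partial>lborel) \<le> ennreal r"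
    using bound by (rule order_trans)
qed

text \<open>Exponentiated form of the supporting line at \<open>m\<close> of the concave function
  \<open>ln (cap_volume K w s)\<close>. The supporting line exists because caps above the minimal level \<open>y \<bullet> w\<close> have positive
  volume; at and below that level the cap is a null set and the bound is trivial.\<close>

lemma cap_volume_exponential_bound:
  fixes K :: "'a::euclidean_space set"
  assumes K: "convex_body K" and w: "w \<noteq> 0" and y: "y \<in> K" "y \<bullet> w < m"
    and min: "\<And>x. x \<in> K \<Longrightarrow> y \<bullet> w \<le> x \<bullet> w"
  shows "\<exists>d. \<forall>s. cap_volume K w s \<le> cap_volume K w m * exp (d * (s - m))"
proof -
  let ?V = "cap_volume K w" and ?I = "{y \<bullet> w<..}"
  have pos: "?V s > 0" if "s \<in> ?I" for s
    using convex_body_measure_pos[OF convex_body_cap[OF K y(1)]] that unfolding cap_volume_def by simp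
  have conv: "convex_on ?I (\<lambda>s. - ln (?V s))"
  proof (rule convex_onI)
    fix t s s' :: real assume t: "0 < t" "t < 1" and s: "s \<in> ?I" "s' \<in> ?I"
    have "?V s powr (1 - t) * ?V s' powr t \<le> ?V ((1 - t) * s + t * s')"
      using cap_volume_log_concave[OF K w y(1), of s s' "1 - t" t] t s by simp
    moreover have "?V s powr (1 - t) * ?V s' powr t > 0" using pos[OF s(1)] pos[OF s(2)] by simp
    ultimately have "ln (?V s powr (1 - t) * ?V s' powr t) \<le> ln (?V ((1 - t) * s + t * s'))"
      by (intro ln_mono) auto
    then show "- ln (?V ((1 - t) *\<^sub>R s + t *\<^sub>R s')) \<le> (1 - t) * - ln (?V s) + t * - ln (?V s')"
      using pos[OF s(1)] pos[OF s(2)] by (simp add: ln_mult ln_powr)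
  qed simp
  define d where "d = - Inf ((\<lambda>t. (- ln (?V m) - - ln (?V t)) / (m - t)) ` ({m<..} \<inter> ?I))"
  have bound: "?V s \<le> ?V m * exp (d * (s - m))" if s: "s \<in> ?I" for s
  proof -
    have "m \<in> interior ?I" using y(2) by (simp add: interior_open)
    from convex_le_Inf_differential[OF conv this s]
    have "ln (?V s) \<le> ln (?V m) + d * (s - m)" by (simp add: d_def)
    then have "exp (ln (?V s)) \<le> exp (ln (?V m) + d * (s - m))" by simp
    then show ?thesis using pos[OF s] pos[of m] y(2) by (simp add: exp_add)
  qed
  moreover have "?V s \<le> ?V m * exp (d * (s - m))" if s: "s \<notin> ?I" for s
  proof -
    have "K \<inter> {x. x \<bullet> w \<le> s} \<subseteq> {x. x \<bullet> w = y \<bullet> w}" using min s by fastforce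
    then have "negligible (K \<inter> {x. x \<bullet> w \<le> s})" by (rule negligible_subset[OF negligible_level_set[OF w]])
    then have "?V s = 0" by (simp add: cap_volume_def negligible_imp_measure0)
    then show ?thesis by (simp add: cap_volume_def)
  qed
  ultimately show ?thesis by blast
qed

text \<open>With \<open>b\<close> the height at which the exponential bound reaches the full volume, the mean of
  \<open>b - x \<bullet> w\<close> over \<open>K\<close> is at most \<open>1 / d\<close>, the integral of \<open>exp (d * (s - b))\<close> over \<open>s \<le> b\<close>. As \<open>m\<close> is the mean
  of \<open>x \<bullet> w\<close>, this reads \<open>b - m \<le> 1 / d\<close>, and multiplication by \<open>d\<close> gives \<open>ln (vol K / V m) \<le> 1\<close>.\<close>

theorem grunbaum:
  fixes K :: "'a::euclidean_space set"
  assumes K: "convex_body K" and w: "w \<noteq> 0"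
  shows "measure lebesgue K / exp 1 \<le> measure lebesgue (K \<inter> {x. x \<bullet> w \<le> center_of_gravity K \<bullet> w})"
proof -
  define m where "m = center_of_gravity K \<bullet> w"
  let ?V = "cap_volume K w" and ?v = "measure lebesgue K"
  have c: "compact K" and v: "?v > 0" using K convex_body_measure_pos by (auto simp: convex_body_def)
  obtain y0 where y0: "y0 \<in> K" "y0 \<bullet> w < m"
    using convex_body_point_below_center_of_gravity[OF K w] unfolding m_def by blast
  have contw: "continuous_on K (\<lambda>x. x \<bullet> w)" by (intro continuous_intros)
  obtain y where y: "y \<in> K" "\<And>x. x \<in> K \<Longrightarrow> y \<bullet> w \<le> x \<bullet> w"
    using continuous_attains_inf[OF c _ contw] y0(1) by blast
  obtain z where z: "z \<in> K" "\<And>x. x \<in> K \<Longrightarrow> x \<bullet> w \<le> z \<bullet> w"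
    using continuous_attains_sup[OF c _ contw] y0(1) by blast
  have ym: "y \<bullet> w < m" using y0 y(2) by fastforce
  have Vm: "?V m > 0"
    using convex_body_measure_pos[OF convex_body_cap[OF K y(1) ym]] unfolding cap_volume_def .
  obtain d where d: "\<And>s. ?V s \<le> ?V m * exp (d * (s - m))"
    using cap_volume_exponential_bound[OF K w y(1) ym y(2)] by blast
  show ?thesis
  proof (cases "?V m < ?v")
    case False
    moreover have "?v / exp 1 \<le> ?v" using v by (simp add: field_simps)
    ultimately show ?thesis by (simp add: cap_volume_def m_def)
  next
    case True
    \<comment> \<open>A supporting line with \<open>d \<le> 0\<close> would bound the volume of all of \<open>K\<close> by \<open>?V m\<close>.\<close>
    have "d > 0"
    proof -
      have top: "K \<inter> {x. x \<bullet> w \<le> z \<bullet> w} = K" using z(2) by blast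
      have "m < z \<bullet> w"
      proof (rule ccontr)
        assume "\<not> ?thesis"
        then have "K \<inter> {x. x \<bullet> w \<le> m} = K" using z(2) by fastforce
        then show False using True by (simp add: cap_volume_def)
      qed
      moreover have "?v \<le> ?V m * exp (d * (z \<bullet> w - m))" using d[of "z \<bullet> w"] top by (simp add: cap_volume_def)
      then have "?V m * 1 < ?V m * exp (d * (z \<bullet> w - m))" using True by simp
      then have "d * (z \<bullet> w - m) > 0" using Vm by (simp only: mult_less_cancel_left_pos one_less_exp_iff)
      ultimately show ?thesis by (simp add: zero_less_mult_iff)
    qed
    define b where "b = m + ln (?v / ?V m) / d"
    have bm: "m \<le> b" using True Vm \<open>d > 0\<close> by (simp add: b_def)
    have "?V m * exp (d * (s - m)) = ?v * exp (d * (s - b))" for s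
    proof -
      have "d * (s - b) = d * (s - m) - ln (?v / ?V m)" using \<open>d > 0\<close> by (simp add: b_def field_simps)
      then show ?thesis using v Vm by (simp add: exp_diff)
    qed
    then have Vb: "?V s \<le> ?v * exp (d * (s - b))" for s using d[of s] by simp
    have "(\<integral>\<^sup>+s. ennreal (?V s) * indicator {y \<bullet> w..b} s \<partial>lborel)
        \<le> (\<integral>\<^sup>+s. ennreal (?v * exp (d * (s - b))) * indicator {y \<bullet> w..b} s \<partial>lborel)"
      using Vb by (intro nn_integral_mono mult_right_mono ennreal_leI) auto
    also have "\<dots> = ennreal (?v / d * exp (d * (b - b)) - ?v / d * exp (d * (y \<bullet> w - b)))"
      using v \<open>d > 0\<close> ym bm by (intro nn_integral_FTC_Icc) (auto intro!: derivative_eq_intros)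
    also have "\<dots> \<le> ennreal (?v / d)"
      using v \<open>d > 0\<close> by (intro ennreal_leI) simp
    finally have "(LINT x|lborel. indicator K x * (b - x \<bullet> w)) \<le> ?v / d"
      using v \<open>d > 0\<close> y(2) by (intro integral_affine_le_integral_cap_volume[OF c, of "y \<bullet> w"]) auto
    moreover have "(LINT x|lborel. indicator K x * (b - x \<bullet> w)) = ?v * (b - m)"
      using integral_affine_eq_center_of_gravity[OF K, of b "- w"] by (simp add: m_def)
    ultimately have "?v * (b - m) \<le> ?v * (1 / d)" by simp
    then have "b - m \<le> 1 / d" using v by (simp only: mult_le_cancel_left_pos)
    then have "ln (?v / ?V m) \<le> 1" using \<open>d > 0\<close> by (simp add: b_def field_simps)
    then have "?v / ?V m \<le> exp 1" using v Vm by (metis divide_pos_pos exp_le_cancel_iff exp_ln)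
    then have "?v / exp 1 \<le> ?V m" using Vm by (simp add: field_simps)
    then show ?thesis by (simp add: cap_volume_def m_def)
  qed
qed

text \<open>The removed part is the half-space in direction \<open>- w\<close>, to which Gruenbaum's theorem
  applies. The remaining set is again a convex body because some point of \<open>K\<close> lies strictly inside the
  kept half-space, so the estimate can be iterated.\<close>

corollary center_of_gravity_cut:
  fixes K :: "'a::euclidean_space set"
  assumes K: "convex_body K" and w: "w \<noteq> 0"
  shows "convex_body (K \<inter> {x. (x - center_of_gravity K) \<bullet> w \<le> 0})"
    and "measure lebesgue (K \<inter> {x. (x - center_of_gravity K) \<bullet> w \<le> 0}) \<le> (1 - 1 / exp 1) * measure lebesgue K"
proof -
  let ?m = "center_of_gravity K \<bullet> w" and ?v = "measure lebesgue K"
  have eq: "{x. (x - center_of_gravity K) \<bullet> w \<le> 0} = {x. x \<bullet> w \<le> ?m}" by (simp add: inner_diff_left)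
  obtain y where "y \<in> K" "y \<bullet> w < ?m" using convex_body_point_below_center_of_gravity[OF K w] by blast
  then show "convex_body (K \<inter> {x. (x - center_of_gravity K) \<bullet> w \<le> 0})"
    unfolding eq by (rule convex_body_cap[OF K])
  have Km: "K \<in> lmeasurable" using K by (rule convex_body_lmeasurable)
  have "?v / exp 1 \<le> measure lebesgue (K \<inter> {x. x \<bullet> w \<ge> ?m})"
    using grunbaum[OF K, of "- w"] w by simp
  moreover have "measure lebesgue (K \<inter> {x. x \<bullet> w < ?m}) = measure lebesgue (K \<inter> {x. x \<bullet> w \<le> ?m})"
  proof (rule measure_negligible_symdiff[OF lmeasurable_Int_halfspace(3)[OF Km]])
    show "negligible (K \<inter> {x. x \<bullet> w \<le> ?m} - K \<inter> {x. x \<bullet> w < ?m} \<union>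
        (K \<inter> {x. x \<bullet> w < ?m} - K \<inter> {x. x \<bullet> w \<le> ?m}))"
      by (rule negligible_subset[OF negligible_level_set[OF w, of ?m]]) auto
  qed
  ultimately show "measure lebesgue (K \<inter> {x. (x - center_of_gravity K) \<bullet> w \<le> 0}) \<le> (1 - 1 / exp 1) * ?v"
    unfolding eq left_diff_distrib using measure_split_halfspace[OF Km, of w ?m] by simp
qed

section \<open>Convergence of the center of gravity method\<close>

lemma center_of_gravity_method_localizers:
  fixes X :: "'a::euclidean_space set"
  assumes X: "convex_body X" and cg: "center_of_gravity_method X f S c w"
    and w: "\<And>s. 1 \<le> s \<Longrightarrow> s \<le> k \<Longrightarrow> w s \<noteq> 0"
  shows "convex_body (S (k + 1))"
    and "measure lebesgue (S (k + 1)) \<le> (1 - 1 / exp 1) ^ k * measure lebesgue X"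
    and "x \<in> X \<Longrightarrow> x \<notin> S (k + 1) \<Longrightarrow> \<exists>s\<in>{1..k}. (x - c s) \<bullet> w s > 0"
proof -
  let ?q = "1 - 1 / exp (1::real)"
  have "k' \<le> k \<Longrightarrow> convex_body (S (k' + 1)) \<and> measure lebesgue (S (k' + 1)) \<le> ?q ^ k' * measure lebesgue X \<and>
    (\<forall>x\<in>X - S (k' + 1). \<exists>s\<in>{1..k'}. (x - c s) \<bullet> w s > 0)" for k'
  proof (induction k')
    case 0
    then show ?case using cg X unfolding center_of_gravity_method_def by simp
  next
    case (Suc k')
    let ?K = "S (k' + 1)"
    have IH: "convex_body ?K" "measure lebesgue ?K \<le> ?q ^ k' * measure lebesgue X"
      "\<And>x. x \<in> X - ?K \<Longrightarrow> \<exists>s\<in>{1..k'}. (x - c s) \<bullet> w s > 0"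
      using Suc by auto
    have "k' + 1 \<ge> 1" by simp
    then have step: "c (k' + 1) = center_of_gravity ?K"
      "S (Suc k' + 1) = ?K \<inter> {x. (x - c (k' + 1)) \<bullet> w (k' + 1) \<le> 0}"
      using cg unfolding center_of_gravity_method_def by (blast, simp)
    have wk: "w (k' + 1) \<noteq> 0" using w Suc.prems by simp
    have "convex_body (S (Suc k' + 1))"
      unfolding step by (rule center_of_gravity_cut(1)[OF IH(1) wk])
    moreover have "measure lebesgue (S (Suc k' + 1)) \<le> ?q ^ Suc k' * measure lebesgue X"
    proof -
      have "measure lebesgue (S (Suc k' + 1)) \<le> ?q * measure lebesgue ?K"
        unfolding step by (rule center_of_gravity_cut(2)[OF IH(1) wk])
      also have "\<dots> \<le> ?q * (?q ^ k' * measure lebesgue X)"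
        using IH(2) by (intro mult_left_mono) auto
      finally show ?thesis by simp
    qed
    moreover have "\<exists>s\<in>{1..Suc k'}. (x - c s) \<bullet> w s > 0" if x: "x \<in> X - S (Suc k' + 1)" for x
    proof (cases "x \<in> ?K")
      case True
      then have "(x - c (k' + 1)) \<bullet> w (k' + 1) > 0" using x unfolding step(2) by auto
      then show ?thesis by (intro bexI[of _ "k' + 1"]) auto
    next
      case False
      then obtain s where "s \<in> {1..k'}" "(x - c s) \<bullet> w s > 0" using IH(3)[of x] x by blast
      then show ?thesis by (intro bexI[of _ s]) auto
    qed
    ultimately show ?case by blast
  qed
  from this[of k] show "convex_body (S (k + 1))"
    "measure lebesgue (S (k + 1)) \<le> ?q ^ k * measure lebesgue X"
    "x \<in> X \<Longrightarrow> x \<notin> S (k + 1) \<Longrightarrow> \<exists>s\<in>{1..k}. (x - c s) \<bullet> w s > 0"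
    by blast+
qed

lemma cut_point_value_less:
  assumes "g \<in> subdifferential X f p" "y \<in> X" "(y - p) \<bullet> g > 0"
  shows "f p < f y"
proof -
  have "f p - f y \<le> g \<bullet> (p - y)" using assms(1,2) unfolding subdifferential_def by blast
  also have "\<dots> = - ((y - p) \<bullet> g)" by (simp add: inner_commute inner_diff_right)
  finally show ?thesis using assms(3) by simp
qed

text \<open>The copy of \<open>X\<close> shrunk towards \<open>z\<close> by the factor \<open>\<epsilon>\<close> is larger in volume than what
  the cuts leave, so one of its points \<open>y\<close> was cut off by some query \<open>c s\<close>. The subgradient at \<open>c s\<close> then
  gives \<open>f (c s) < f y\<close>, and \<open>f y\<close> is close to \<open>f z\<close> by convexity.\<close>

lemma center_of_gravity_method_query_near_minimum:
  fixes X :: "'a::euclidean_space set"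
  assumes X: "convex_body X" and cg: "center_of_gravity_method X f S c w"
    and f: "convex_on X f" "f \<in> X \<rightarrow> {-B..B}"
    and z: "z \<in> X" and k: "k \<ge> 1"
    and w: "\<And>s. 1 \<le> s \<Longrightarrow> s \<le> k \<Longrightarrow> w s \<noteq> 0"
    and \<epsilon>: "(1 - 1 / exp 1) powr (real k / real DIM('a)) < \<epsilon>" "\<epsilon> \<le> 1"
  shows "\<exists>s\<in>{1..k}. f (c s) \<le> f z + 2 * B * \<epsilon>"
proof -
  let ?q = "1 - 1 / exp (1::real)" and ?n = "DIM('a)"
  have q: "0 < ?q" by simp
  have \<epsilon>0: "0 < \<epsilon>" using \<epsilon>(1) by (meson le_less_trans powr_ge_zero)
  have "(?q powr (real k / real ?n)) ^ ?n < \<epsilon> ^ ?n"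
    using \<epsilon>(1) by (intro power_strict_mono) auto
  moreover have "(?q powr (real k / real ?n)) ^ ?n = ?q ^ k"
    using q by (simp add: powr_realpow[symmetric] powr_powr)
  ultimately have q\<epsilon>: "?q ^ k < \<epsilon> ^ ?n" by simp
  let ?Y = "(\<lambda>x. \<epsilon> *\<^sub>R x + (1 - \<epsilon>) *\<^sub>R z) ` X"
  have YX: "?Y \<subseteq> X"
    using X z \<epsilon>0 \<epsilon>(2) unfolding convex_body_def by (auto intro!: convexD)
  have S: "convex_body (S (k + 1))" "measure lebesgue (S (k + 1)) \<le> ?q ^ k * measure lebesgue X"
    using center_of_gravity_method_localizers[OF X cg w] by blast+
  have "\<not> ?Y \<subseteq> S (k + 1)"
  proof
    assume "?Y \<subseteq> S (k + 1)"
    moreover have "compact ?Y"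
      using X unfolding convex_body_def by (intro compact_continuous_image continuous_intros) auto
    ultimately have "measure lebesgue ?Y \<le> measure lebesgue (S (k + 1))"
      by (intro measure_mono_fmeasurable fmeasurableD convex_body_lmeasurable[OF S(1)] lmeasurable_compact)
    also have "\<dots> \<le> ?q ^ k * measure lebesgue X" by (rule S(2))
    also have "\<dots> < \<epsilon> ^ ?n * measure lebesgue X"
      using q\<epsilon> convex_body_measure_pos[OF X] by simp
    also have "\<dots> = measure lebesgue ?Y" using \<epsilon>0 by (simp add: measure_lebesgue_affine)
    finally show False by simp
  qed
  then obtain x where x: "x \<in> X" and out: "\<epsilon> *\<^sub>R x + (1 - \<epsilon>) *\<^sub>R z \<notin> S (k + 1)" by blast
  let ?y = "\<epsilon> *\<^sub>R x + (1 - \<epsilon>) *\<^sub>R z"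
  have y: "?y \<in> X" using YX x by blast
  obtain s where s: "s \<in> {1..k}" "(?y - c s) \<bullet> w s > 0"
    using center_of_gravity_method_localizers(3)[OF X cg w y out] by blast
  have "w s \<in> subdifferential X f (c s)" using cg s(1) unfolding center_of_gravity_method_def by auto
  then have "f (c s) < f ?y" using y s(2) by (rule cut_point_value_less)
  also have "f ?y \<le> \<epsilon> * f x + (1 - \<epsilon>) * f z"
    using f(1) x z \<epsilon>0 \<epsilon>(2) unfolding convex_on_def by simp
  also have "\<dots> = f z + \<epsilon> * (f x - f z)" by (simp add: algebra_simps)
  also have "\<dots> \<le> f z + \<epsilon> * (2 * B)"
  proof -
    have "f x \<in> {-B..B}" "f z \<in> {-B..B}" using f(2) x z by blast+
    then have "f x - f z \<le> 2 * B" by simp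
    then show ?thesis using \<epsilon>0 by (intro add_left_mono mult_left_mono) auto
  qed
  finally show ?thesis using s(1) by (intro bexI[of _ s]) (simp_all add: mult.commute)
qed

theorem theorem2p1:
  fixes X :: "(real ^ 'n) set"
    and f :: "real ^ 'n \<Rightarrow> real"
    and B :: real
    and S :: "nat \<Rightarrow> (real ^ 'n) set"
    and c w :: "nat \<Rightarrow> real ^ 'n"
    and t :: nat
    and x\<^sub>t :: "real ^ 'n"
  assumes "convex_body X"
    and "f \<in> X \<rightarrow> {-B..B}"
    and "continuous_on X f"
    and "convex_on X f"
    and "center_of_gravity_method X f S c w"
    and "t \<ge> 1"
    and "is_arg_min f (\<lambda>p. p \<in> c ` {1..t}) x\<^sub>t"
  shows "f x\<^sub>t - (LEAST m. m \<in> f ` X) \<le> 2 * B * (1 - 1 / exp 1) powr (real t / real CARD('n))"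
proof -
  let ?\<epsilon>0 = "(1 - 1 / exp (1::real)) powr (real t / real CARD('n))"
  have "compact X" "X \<noteq> {}" using assms(1) interior_subset unfolding convex_body_def by auto
  then obtain z where z: "z \<in> X" "\<And>y. y \<in> X \<Longrightarrow> f z \<le> f y"
    using continuous_attains_inf[OF _ _ assms(3)] by blast
  have least: "(LEAST m. m \<in> f ` X) = f z" using z by (intro Least_equality) auto
  have best: "f x\<^sub>t \<le> f (c s)" if "s \<in> {1..t}" for s
    using assms(7) that unfolding is_arg_min_def by (auto simp: not_less)
  have "f z \<in> {-B..B}" using assms(2) z(1) by blast
  then have B: "B \<ge> 0" by simp
  have "f x\<^sub>t - f z \<le> 2 * B * ?\<epsilon>0"
  \<comment> \<open>A zero subgradient certifies a minimiser; without one, every query cuts properly.\<close>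
  proof (cases "\<exists>s\<in>{1..t}. w s = 0")
    case True
    then obtain s where s: "s \<in> {1..t}" "w s = 0" by blast
    then have "0 \<in> subdifferential X f (c s)"
      using assms(5) unfolding center_of_gravity_method_def by (metis atLeastAtMost_iff)
    then have "f (c s) \<le> f z" using z(1) unfolding subdifferential_def by auto
    then have "f x\<^sub>t - f z \<le> 0" using best[OF s(1)] by simp
    also have "0 \<le> 2 * B * ?\<epsilon>0" using B by simp
    finally show ?thesis .
  next
    case False
    have "?\<epsilon>0 < 1 powr (real t / real CARD('n))"
      using assms(6) by (intro powr_less_mono2) auto
    then have \<epsilon>0: "?\<epsilon>0 < 1" by simp
    have bound: "f x\<^sub>t - f z \<le> 2 * B * \<epsilon>" if "?\<epsilon>0 < \<epsilon>" "\<epsilon> < 1" for \<epsilon>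
    proof -
      have "\<exists>s\<in>{1..t}. f (c s) \<le> f z + 2 * B * \<epsilon>"
        using that False
        by (intro center_of_gravity_method_query_near_minimum[OF assms(1,5,4,2) z(1) assms(6)]) auto
      then show ?thesis using best by force
    qed
    show ?thesis
    proof (cases "B = 0")
      case True
      obtain \<epsilon> where "?\<epsilon>0 < \<epsilon>" "\<epsilon> < 1" using dense[OF \<epsilon>0] by blast
      then show ?thesis using bound True by force
    next
      case nz: False
      have "(f x\<^sub>t - f z) / (2 * B) \<le> ?\<epsilon>0"
      proof (rule dense_ge_bounded[OF \<epsilon>0])
        fix \<epsilon> assume "?\<epsilon>0 < \<epsilon>" "\<epsilon> < 1"
        then show "(f x\<^sub>t - f z) / (2 * B) \<le> \<epsilon>" using bound[of \<epsilon>] B nz by (simp add: field_simps)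
      qed
      then show ?thesis using B nz by (simp add: field_simps)
    qed
  qed
  then show ?thesis unfolding least .
qed

end
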